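(* Let $\overline{L}:L^2_\rho\to L^2_\rho$ be a positive semidefinite self-adjoint trace-class operator with infinitely many positive eigenvalues $\lambda_1\ge\lambda_2\ge\cdots>0$ and corresponding orthonormal eigenfunctions $\{\psi_i\}_{i\ge1}$. Let $0<a\le b<\infty$ be constants and assume the following. (Spectrum decay) $\lambda_i=p_i^{-1}f(i)$ for all $i\ge 1$, where either $f(x)=e^{-\theta(x-1)}$ with $\theta>0$ (exponential case) or $f(x)=x^{-\theta}$ with $\theta>1$ (polynomial case), and $a\le p_i^{-1}\le b$ for every $i$. ($r$-smoothness) $\phi_*=\sum_{i}c_i\psi_i\in H_G^r\subset L^2_\rho$ with $|c_i|=\widetilde p_i\lambda_i^r$ for all $i$, where $a\le\widetilde p_i^{-1}\le b$ for every $i$, and $r>0$ in the exponential case, $r>\frac{1}{2\theta}$ in the polynomial case. Set $\beta=1$ in the exponential case and $\beta=\theta^{-1}+1$ in the polynomial case. For $s\ge 0$, $\sigma>0$ and $\lambda>0$ let $$e(\lambda;s)=\sum_{i}(\lambda_i^{s+1}+\lambda)^{-2}\left(\sigma^2\lambda_i^{2s+1}+\lambda^2c_i^2\right),$$ and let $\lambda_*=\lambda_*(\sigma)\in\arg\min_{\lambda>0}e(\lambda;s)$. Then, for fixed $s\geq 0$, as $\sigma\to0$, $$\lambda_*\simeq\begin{cases}\sigma^{\frac{2s+2}{2r+1}}, & s>r-\frac{\beta+1}{2},\\[2pt] \sigma^{\frac{2s+2}{2s+2+\beta}}, & s<r-\frac{\beta+1}{2},\end{cases}\qquad e(\lambda_*;s)\simeq\begin{cases}\sigma^{2-\frac{2\beta}{2r+1}},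 & s>r-\frac{\beta+1}{2},\\[2pt] \sigma^{2-\frac{2\beta}{2s+2+\beta}}, & s<r-\frac{\beta+1}{2}.\end{cases}$$
   Context: $\rho$ is a probability measure with compact support and $L^2_\rho$ is the space of functions square-integrable with respect to $\rho$. The operator $\overline{L}$ is the normal operator $\overline{L}=\frac1n\sum_{k=1}^nL_k^*L_k$ of a linear inverse problem with bounded operators $L_k:L^2_\rho\to\mathbb{Y}$ into a Hilbert space $\mathbb{Y}$ ($n$ fixed). For $t\ge0$, the fractional Sobolev space $H_G^t=\overline{L}^{t/2}(L^2_\rho)$ consists of all $\phi=\sum_{i}a_i\psi_i$ with $\sum_i\lambda_i^{-t}a_i^2<\infty$, with norm $\|\phi\|_{H_G^t}^2=\sum_i\lambda_i^{-t}a_i^2$. The function $e(\lambda;s)$ is the expected squared error $\mathbb{E}\|\widehat\phi^s_\lambda-\phi_*\|_{L^2_\rho}^2$ of the regularized estimator $\widehat\phi_\lambda^s=(\overline{L}^{1+s}+\lambda I)^{-1}\overline{L}^s\phi^y$, where $\phi^y=\overline{L}\phi_*+\sum_i\sigma\lambda_i^{1/2}\xi_i\psi_i$ with $\xi_i$ i.i.d. standard Gaussian. For positive quantities $X(\sigma),Y(\sigma)$, "$X\simeq Y$ as $\sigma\to0$" means that they are of the same order: there are constants $0<C\le C'<\infty$ and $\sigma_0>0$, independent of $\sigma$, such that $C\,Y(\sigma)\le X(\sigma)\le C'\,Y(\sigma)$ for all $0<\sigma<\sigma_0$. *)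

theory Defs
  imports "HOL-Probability.Probability"
begin

subsection \<open>The Hilbert space of square-integrable functions\<close>

text \<open>
  The measure is a variable, so the quotient by almost-everywhere equality cannot be a type.
  Elements of L2 are represented by functions, and equalities between elements of L2 are stated
  almost everywhere.
\<close>

definition L2_space :: "'x measure \<Rightarrow> ('x \<Rightarrow> real) set" where
  "L2_space M = {f \<in> borel_measurable M. integrable M (\<lambda>x. (f x)\<^sup>2)}"

definition L2_inner :: "'x measure \<Rightarrow> ('x \<Rightarrow> real) \<Rightarrow> ('x \<Rightarrow> real) \<Rightarrow> real" where
  "L2_inner M f g = (\<integral>x. f x * g x \<partial>M)"

definition L2_norm :: "'x measure \<Rightarrow> ('x \<Rightarrow> real) \<Rightarrow> real" where
  "L2_norm M f = sqrt (L2_inner M f f)"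

definition L2_sums :: "'x measure \<Rightarrow> (nat \<Rightarrow> 'x \<Rightarrow> real) \<Rightarrow> ('x \<Rightarrow> real) \<Rightarrow> bool" where
  "L2_sums M u f \<longleftrightarrow> (\<forall>i. u i \<in> L2_space M) \<and> f \<in> L2_space M \<and>
     (\<lambda>n. L2_norm M (\<lambda>x. f x - (\<Sum>i<n. u i x))) \<longlonglongrightarrow> 0"

definition L2_orthonormal :: "'x measure \<Rightarrow> 'i set \<Rightarrow> ('i \<Rightarrow> 'x \<Rightarrow> real) \<Rightarrow> bool" where
  "L2_orthonormal M I e \<longleftrightarrow> (\<forall>i\<in>I. e i \<in> L2_space M) \<and>
     (\<forall>i\<in>I. \<forall>j\<in>I. L2_inner M (e i) (e j) = (if i = j then 1 else 0))"

definition L2_orthonormal_basis :: "'x measure \<Rightarrow> ('x \<Rightarrow> real) set \<Rightarrow> bool" where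
  "L2_orthonormal_basis M B \<longleftrightarrow> L2_orthonormal M B (\<lambda>h. h) \<and>
     (\<forall>f\<in>L2_space M. (\<forall>h\<in>B. L2_inner M f h = 0) \<longrightarrow> (AE x in M. f x = 0))"

subsection \<open>Operators\<close>

text \<open>Linearity and boundedness together imply that almost everywhere equal arguments have
  almost everywhere equal images, so such a map does act on classes of functions.\<close>

definition L2_bounded_operator ::
    "'x measure \<Rightarrow> (('x \<Rightarrow> real) \<Rightarrow> ('x \<Rightarrow> real)) \<Rightarrow> bool" where
  "L2_bounded_operator M T \<longleftrightarrow>
     (\<forall>f\<in>L2_space M. T f \<in> L2_space M) \<and>
     (\<forall>f\<in>L2_space M. \<forall>g\<in>L2_space M. AE x in M. T (\<lambda>y. f y + g y) x = T f x + T g x) \<and>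
     (\<forall>k. \<forall>f\<in>L2_space M. AE x in M. T (\<lambda>y. k * f y) x = k * T f x) \<and>
     (\<exists>K. \<forall>f\<in>L2_space M. L2_norm M (T f) \<le> K * L2_norm M f)"

definition L2_psd_selfadjoint ::
    "'x measure \<Rightarrow> (('x \<Rightarrow> real) \<Rightarrow> ('x \<Rightarrow> real)) \<Rightarrow> bool" where
  "L2_psd_selfadjoint M T \<longleftrightarrow> L2_bounded_operator M T \<and>
     (\<forall>f\<in>L2_space M. \<forall>g\<in>L2_space M. L2_inner M (T f) g = L2_inner M f (T g)) \<and>
     (\<forall>f\<in>L2_space M. 0 \<le> L2_inner M (T f) f)"

text \<open>The operator \<open>A\<close> below is the absolute value of \<open>T\<close>: it is positive semidefinite and
  its square is the adjoint of \<open>T\<close> composed with \<open>T\<close>.\<close>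

definition L2_trace_class ::
    "'x measure \<Rightarrow> (('x \<Rightarrow> real) \<Rightarrow> ('x \<Rightarrow> real)) \<Rightarrow> bool" where
  "L2_trace_class M T \<longleftrightarrow> L2_bounded_operator M T \<and>
     (\<exists>A. L2_psd_selfadjoint M A \<and>
        (\<forall>f\<in>L2_space M. \<forall>g\<in>L2_space M. L2_inner M (A f) (A g) = L2_inner M (T f) (T g)) \<and>
        (\<exists>B. L2_orthonormal_basis M B \<and> (\<lambda>h. L2_inner M (A h) h) summable_on B))"

text \<open>Sequences are indexed from 0, so \<open>lam i\<close> and \<open>\<psi> i\<close> are the eigenpair with index \<open>i + 1\<close>
  in the usual numbering from 1. The last conjunct says that the positive eigenvalues are listed
  completely, with multiplicity.\<close>

definition positive_eigensystem ::
    "'x measure \<Rightarrow> (('x \<Rightarrow> real) \<Rightarrow> ('x \<Rightarrow> real)) \<Rightarrow> (nat \<Rightarrow> real) \<Rightarrow> (nat \<Rightarrow> 'x \<Rightarrow> real) \<Rightarrow> bool" where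
  "positive_eigensystem M T lam \<psi> \<longleftrightarrow>
     (\<forall>i. 0 < lam i) \<and> decseq lam \<and> L2_orthonormal M UNIV \<psi> \<and>
     (\<forall>i. AE x in M. T (\<psi> i) x = lam i * \<psi> i x) \<and>
     (\<forall>\<mu>>0. \<forall>f\<in>L2_space M. (AE x in M. T f x = \<mu> * f x) \<and> (\<forall>i. L2_inner M f (\<psi> i) = 0)
        \<longrightarrow> (AE x in M. f x = 0))"

subsection \<open>Sobolev spaces, the error function and orders of magnitude\<close>

definition sobolev_space ::
    "'x measure \<Rightarrow> (nat \<Rightarrow> real) \<Rightarrow> (nat \<Rightarrow> 'x \<Rightarrow> real) \<Rightarrow> real \<Rightarrow> ('x \<Rightarrow> real) set" where
  "sobolev_space M lam \<psi> t =
     {f. \<exists>a. L2_sums M (\<lambda>i x. a i * \<psi> i x) f \<and> summable (\<lambda>i. lam i powr (- t) * (a i)\<^sup>2)}"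

definition measure_support :: "'x::topological_space measure \<Rightarrow> 'x set" where
  "measure_support M = {x. \<forall>U. open U \<and> x \<in> U \<longrightarrow> emeasure M U > 0}"

definition regularization_error ::
    "(nat \<Rightarrow> real) \<Rightarrow> (nat \<Rightarrow> real) \<Rightarrow> real \<Rightarrow> real \<Rightarrow> real \<Rightarrow> real" where
  "regularization_error lam c s \<sigma> l =
     (\<Sum>i. (\<sigma>\<^sup>2 * lam i powr (2 * s + 1) + l\<^sup>2 * (c i)\<^sup>2) / (lam i powr (s + 1) + l)\<^sup>2)"

definition same_order_at_0 :: "(real \<Rightarrow> real) \<Rightarrow> (real \<Rightarrow> real) \<Rightarrow> bool" where
  "same_order_at_0 X Y \<longleftrightarrow>
     (\<exists>C C' \<sigma>0. 0 < C \<and> C \<le> C' \<and> 0 < \<sigma>0 \<and>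
        (\<forall>\<sigma>. 0 < \<sigma> \<and> \<sigma> < \<sigma>0 \<longrightarrow> C * Y \<sigma> \<le> X \<sigma> \<and> X \<sigma> \<le> C' * Y \<sigma>))"

end

(* Write l = mu^(s+1). Up to constants the error is sigma^2 V(l) + l^2 W(l), where V and W are the
   sums of lam_i^t / (lam_i^(s+1) + l)^2 for t = 2s+1 and t = 2r. Both decay laws put about
   x^(1 - beta) eigenvalues in a dyadic interval around x. Splitting the sums into dyadic shells
   around mu therefore gives the order mu^(t + 1 - beta - 2(s+1)) whenever beta - 1 < t and
   t < 2(s+1) + beta - 1; for larger t the sum is bounded above and away from 0. This always
   determines V, and the two cases of the theorem are the two regimes of W. It remains to minimise
   sigma^2 l^(-p) + l^q, where the two terms balance at l = sigma^(2 / (p + q)); large l are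
   excluded by the bias of the first coefficient. *)

theory Submission
  imports Defs
begin

section \<open>Orders of magnitude and the minimisation of a sum of two powers\<close>

lemma same_order_at_0I:
  fixes X Y :: "real \<Rightarrow> real"
  assumes "0 < C" "0 < \<sigma>0" "\<And>\<sigma>. 0 < \<sigma> \<Longrightarrow> 0 \<le> Y \<sigma>"
    and "\<And>\<sigma>. 0 < \<sigma> \<Longrightarrow> \<sigma> < \<sigma>0 \<Longrightarrow> C * Y \<sigma> \<le> X \<sigma>"
    and "\<And>\<sigma>. 0 < \<sigma> \<Longrightarrow> \<sigma> < \<sigma>0 \<Longrightarrow> X \<sigma> \<le> C' * Y \<sigma>"
  shows "same_order_at_0 X Y"
  unfolding same_order_at_0_def
proof (intro exI conjI allI impI)
  \<comment> \<open>The definition demands ordered constants; enlarging the upper one is harmless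
    because \<open>Y\<close> is nonnegative.\<close>
  show "C \<le> max C C'" by simp
  fix \<sigma> :: real assume "0 < \<sigma> \<and> \<sigma> < \<sigma>0"
  then show "C * Y \<sigma> \<le> X \<sigma>" "X \<sigma> \<le> max C C' * Y \<sigma>"
    using assms(3-5)[of \<sigma>] mult_right_mono[of C' "max C C'" "Y \<sigma>"] by auto
qed (use assms in auto)

lemma powr_less_of_less_root:
  fixes x y e :: real
  assumes "0 < x" "0 < y" "0 < e" "x < y powr (1 / e)"
  shows "x powr e < y"
proof -
  have "x powr e < (y powr (1 / e)) powr e"
    using assms by (intro powr_less_mono2) auto
  then show ?thesis using assms by (simp add: powr_powr)
qed

lemma le_root_of_powr_le:
  fixes x y e :: real
  assumes "0 \<le> x" "0 < e" "x powr e \<le> y"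
  shows "x \<le> y powr (1 / e)"
proof -
  have "(x powr e) powr (1 / e) \<le> y powr (1 / e)"
    using assms by (intro powr_mono2) auto
  then show ?thesis using assms by (simp add: powr_powr)
qed

text \<open>The comparison point is \<open>m \<sigma> = \<sigma> powr (2 / (p + q))\<close>, where
  the two terms are equal. Minimality bounds the error at \<open>x \<sigma>\<close> by a multiple of
  \<open>m \<sigma> powr q\<close>. Both terms are nonnegative, so each obeys this bound alone: the
  increasing one bounds \<open>x \<sigma>\<close> from above, the decreasing one from below.\<close>

lemma same_order_minimizer:
  fixes E :: "real \<Rightarrow> real \<Rightarrow> real" and x :: "real \<Rightarrow> real"
  assumes pos: "0 < p" "0 < q" "0 < k1" "0 < k2" "0 < k0" "0 < l0"
    and low: "\<And>\<sigma> l. 0 < \<sigma> \<Longrightarrow> 0 < l \<Longrightarrow> l \<le> l0 \<Longrightarrow> k1 * (\<sigma>\<^sup>2 * l powr (- p) + l powr q) \<le> E \<sigma> l"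
    and up: "\<And>\<sigma> l. 0 < \<sigma> \<Longrightarrow> 0 < l \<Longrightarrow> l \<le> l0 \<Longrightarrow> E \<sigma> l \<le> k2 * (\<sigma>\<^sup>2 * l powr (- p) + l powr q)"
    and far: "\<And>\<sigma> l. 0 < \<sigma> \<Longrightarrow> l0 \<le> l \<Longrightarrow> k0 \<le> E \<sigma> l"
    and min: "\<And>\<sigma>. 0 < \<sigma> \<Longrightarrow> is_arg_min (E \<sigma>) (\<lambda>l. 0 < l) (x \<sigma>)"
  shows "same_order_at_0 x (\<lambda>\<sigma>. \<sigma> powr (2 / (p + q)))" (is ?A)
    and "same_order_at_0 (\<lambda>\<sigma>. E \<sigma> (x \<sigma>)) (\<lambda>\<sigma>. \<sigma> powr (2 * q / (p + q)))" (is ?B)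
proof -
  define m where "m = (\<lambda>\<sigma>::real. \<sigma> powr (2 / (p + q)))"
  \<comment> \<open>The factor lost between the upper bound at \<open>m \<sigma>\<close>, where two
    equal terms produce the 2, and the lower bound at \<open>x \<sigma>\<close>.\<close>
  define R where "R = 2 * k2 / k1"
  \<comment> \<open>The first entry ensures \<open>m \<sigma> < l0\<close>, the second
    \<open>2 * k2 * m \<sigma> powr q < k0\<close>.\<close>
  define \<sigma>0 where "\<sigma>0 = min (l0 powr (1 / (2 / (p + q)))) ((k0 / (2 * k2)) powr (1 / (2 * q / (p + q))))"
  have R: "R > 0" and \<sigma>0: "\<sigma>0 > 0" using pos by (auto simp: R_def \<sigma>0_def)
  have mq: "m \<sigma> powr q = \<sigma> powr (2 * q / (p + q))" for \<sigma>
    by (simp add: m_def powr_powr)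
  have mpq: "m \<sigma> powr (p + q) = \<sigma>\<^sup>2" if "\<sigma> > 0" for \<sigma>
  proof -
    have "2 / (p + q) * (p + q) = 2" using pos by (intro nonzero_eq_divide_eq[THEN iffD1]) auto
    then show ?thesis using that by (simp only: m_def powr_powr) simp
  qed
  have main: "R powr (- 1 / p) * m \<sigma> \<le> x \<sigma> \<and> x \<sigma> \<le> R powr (1 / q) * m \<sigma> \<and>
      k1 * R powr (- q / p) * m \<sigma> powr q \<le> E \<sigma> (x \<sigma>) \<and> E \<sigma> (x \<sigma>) \<le> 2 * k2 * m \<sigma> powr q"
    if \<sigma>: "0 < \<sigma>" "\<sigma> < \<sigma>0" for \<sigma>
  proof -
    have m0: "m \<sigma> > 0" using \<sigma> by (simp add: m_def)
    have ml: "m \<sigma> < l0" unfolding m_def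
      using \<sigma> pos by (intro powr_less_of_less_root) (auto simp: \<sigma>0_def)
    have "m \<sigma> powr q < k0 / (2 * k2)" unfolding mq
      using \<sigma> pos by (intro powr_less_of_less_root) (auto simp: \<sigma>0_def)
    then have mk: "2 * k2 * m \<sigma> powr q < k0" using pos by (simp add: field_simps)
    have x0: "x \<sigma> > 0" and le: "E \<sigma> (x \<sigma>) \<le> E \<sigma> (m \<sigma>)"
      using min[OF \<sigma>(1)] m0 by (auto simp: is_arg_min_linorder)
    have "\<sigma>\<^sup>2 * m \<sigma> powr (- p) = m \<sigma> powr q"
      using m0 by (simp add: mpq[OF \<sigma>(1), symmetric] flip: powr_add)
    then have Em: "E \<sigma> (x \<sigma>) \<le> 2 * k2 * m \<sigma> powr q"
      using le up[OF \<sigma>(1) m0] ml by simp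
    \<comment> \<open>Beyond \<open>l0\<close> the error is at least \<open>k0\<close>, which
      exceeds the bound on the minimum, so the two-term estimates apply at
      \<open>x \<sigma>\<close>.\<close>
    have xl: "x \<sigma> \<le> l0" using far[OF \<sigma>(1), of "x \<sigma>"] Em mk by linarith
    have Ex: "k1 * (\<sigma>\<^sup>2 * x \<sigma> powr (- p) + x \<sigma> powr q) \<le> E \<sigma> (x \<sigma>)"
      using low[OF \<sigma>(1) x0 xl] .
    have s1: "\<sigma>\<^sup>2 * x \<sigma> powr (- p) + x \<sigma> powr q \<le> R * m \<sigma> powr q"
      using order_trans[OF Ex Em] pos by (simp add: R_def field_simps)
    have nn: "0 \<le> \<sigma>\<^sup>2 * x \<sigma> powr (- p)" "0 \<le> x \<sigma> powr q" by auto
    have "x \<sigma> powr q \<le> R * m \<sigma> powr q" using s1 nn by linarith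
    then have "(x \<sigma> / m \<sigma>) powr q \<le> R"
      using m0 x0 by (simp add: powr_divide pos_divide_le_eq)
    then have "x \<sigma> / m \<sigma> \<le> R powr (1 / q)"
      using m0 x0 pos by (intro le_root_of_powr_le) auto
    then have 1: "x \<sigma> \<le> R powr (1 / q) * m \<sigma>" using m0 by (simp add: field_simps)
    \<comment> \<open>Writing \<open>\<sigma>\<^sup>2\<close> as
      \<open>m \<sigma> powr (p + q)\<close> lets \<open>m \<sigma> powr q\<close> cancel and leaves
      a bound on the ratio \<open>m \<sigma> / x \<sigma>\<close>.\<close>
    have "m \<sigma> powr p * m \<sigma> powr q * x \<sigma> powr (- p) \<le> R * m \<sigma> powr q"
      using order_trans[OF add_increasing2[OF nn(2) order_refl] s1]
      by (simp add: powr_add flip: mpq[OF \<sigma>(1)])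
    then have "m \<sigma> powr p * x \<sigma> powr (- p) \<le> R" using m0 by simp
    then have "(m \<sigma> / x \<sigma>) powr p \<le> R"
      using m0 x0 by (simp add: powr_divide powr_minus_divide)
    then have "m \<sigma> / x \<sigma> \<le> R powr (1 / p)"
      using m0 x0 pos by (intro le_root_of_powr_le) auto
    then have 2: "R powr (- 1 / p) * m \<sigma> \<le> x \<sigma>"
      using x0 R by (simp add: powr_minus_divide field_simps)
    \<comment> \<open>For the lower bound on the minimal error, the increasing term at
      \<open>x \<sigma>\<close> suffices.\<close>
    have "(R powr (- 1 / p) * m \<sigma>) powr q \<le> x \<sigma> powr q"
      using 2 m0 R pos by (intro powr_mono2) auto
    then have "k1 * (R powr (- q / p) * m \<sigma> powr q) \<le> k1 * x \<sigma> powr q"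
      using R m0 pos by (simp add: powr_mult powr_powr)
    also have "\<dots> \<le> k1 * (\<sigma>\<^sup>2 * x \<sigma> powr (- p) + x \<sigma> powr q)"
      using nn pos by (intro mult_left_mono) auto
    finally show ?thesis using 1 2 Em Ex by (simp add: mult.assoc)
  qed
  show ?A
    by (rule same_order_at_0I[of "R powr (- 1 / p)" \<sigma>0 _ _ "R powr (1 / q)"])
      (use main R \<sigma>0 in \<open>auto simp: m_def\<close>)
  show ?B
    by (rule same_order_at_0I[of "k1 * R powr (- q / p)" \<sigma>0 _ _ "2 * k2"])
      (use main R \<sigma>0 pos in \<open>auto simp: mq\<close>)
qed

section \<open>Summation over dyadic shells\<close>

text \<open>The absolute value is injective on the nonnegative and on the negative integers, so each
  half is at most one full geometric series.\<close>

lemma sum_int_geometric_le: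
  fixes q :: real
  assumes "0 \<le> q" "q < 1" "finite K"
  shows "(\<Sum>k\<in>K. q ^ nat \<bar>k\<bar>) \<le> 2 / (1 - q)"
proof -
  have half: "(\<Sum>k\<in>J. q ^ nat \<bar>k\<bar>) \<le> 1 / (1 - q)"
    if "finite J" "inj_on (\<lambda>k. nat \<bar>k\<bar>) J" for J :: "int set"
  proof -
    have "(\<Sum>k\<in>J. q ^ nat \<bar>k\<bar>) = (\<Sum>n\<in>(\<lambda>k. nat \<bar>k\<bar>) ` J. q ^ n)"
      using that by (simp add: sum.reindex)
    also have "\<dots> \<le> (\<Sum>n. q ^ n)"
      using that assms by (intro sum_le_suminf) auto
    finally show ?thesis using assms by (simp add: suminf_geometric)
  qed
  have "(\<Sum>k\<in>K. q ^ nat \<bar>k\<bar>) = (\<Sum>k\<in>K \<inter> {0..}. q ^ nat \<bar>k\<bar>) + (\<Sum>k\<in>K \<inter> {..<0}. q ^ nat \<bar>k\<bar>)"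
    using assms(3) by (subst sum.union_disjoint[symmetric]) (auto intro!: sum.cong)
  also have "\<dots> \<le> 1 / (1 - q) + 1 / (1 - q)"
    using assms(3) by (intro add_mono half) (auto simp: inj_on_def)
  finally show ?thesis by simp
qed

text \<open>On the shell \<open>2\<^sup>k \<le> u < 2\<^sup>k\<^sup>+\<^sup>1\<close> a summand is at most
  \<open>2\<^sup>t\<close> times \<open>2 powr (k * t)\<close> if \<open>k < 0\<close> and \<open>2 powr (k * (t - 2 * S))\<close> if \<open>k \<ge> 0\<close>; against the
  \<open>2 powr (- \<alpha> * k)\<close> indices of the shell, both sides decay geometrically.\<close>

lemma dyadic_shell_sum:
  fixes u :: "nat \<Rightarrow> real"
  assumes u: "\<And>i. 0 < u i"
    and shell: "\<And>k::int. finite {i. 2 powr k \<le> u i \<and> u i < 2 * 2 powr k} \<and>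
      real (card {i. 2 powr k \<le> u i \<and> u i < 2 * 2 powr k}) \<le> D * 2 powr (- \<alpha> * k)"
    and t: "0 \<le> \<alpha>" "\<alpha> < t" "t < 2 * S + \<alpha>"
  defines "K \<equiv> 2 powr t * (2 / (1 - 2 powr (- min (t - \<alpha>) (2 * S + \<alpha> - t))))"
  shows "summable (\<lambda>i. u i powr t / (u i powr S + 1)\<^sup>2)" (is "summable ?g")
    and "(\<Sum>i. u i powr t / (u i powr S + 1)\<^sup>2) \<le> D * K"
proof -
  define k where "k = (\<lambda>i. \<lfloor>log 2 (u i)\<rfloor>)"
  \<comment> \<open>The slower of the two decay rates: \<open>t - \<alpha>\<close> towards small
    \<open>u\<close>, \<open>2 * S + \<alpha> - t\<close> towards large \<open>u\<close>.\<close>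
  define \<delta> where "\<delta> = min (t - \<alpha>) (2 * S + \<alpha> - t)"
  have \<delta>: "\<delta> > 0" using t by (simp add: \<delta>_def)
  have k: "2 powr k i \<le> u i" "u i < 2 * 2 powr k i" for i
  proof -
    have "real_of_int (k i) \<le> log 2 (u i)" "log 2 (u i) < real_of_int (k i) + 1"
      by (auto simp: k_def)
    then have "2 powr k i \<le> u i" "u i < 2 powr (k i + 1)"
      using u[of i] by (simp_all add: le_log_iff log_less_iff)
    then show "2 powr k i \<le> u i" "u i < 2 * 2 powr k i" by (simp_all add: powr_add)
  qed
  have D: "D \<ge> 0" using order_trans[OF of_nat_0_le_iff conjunct2[OF shell[of 0]]] by simp
  \<comment> \<open>The denominator is at least 1 and at least \<open>2 powr (2 * S * k i)\<close>;
    the first is the better bound for negative \<open>k i\<close>, the second for positive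
    \<open>k i\<close>.\<close>
  have term_le: "?g i \<le> 2 powr t * (2 powr (k i * t) * min 1 (2 powr (- 2 * S * k i)))" for i
  proof -
    have "u i powr t \<le> (2 * 2 powr k i) powr t"
      using k[of i] u[of i] t by (intro powr_mono2) auto
    then have 1: "u i powr t \<le> 2 powr t * 2 powr (k i * t)" by (simp add: powr_mult powr_powr)
    have "(2 powr k i) powr S \<le> u i powr S"
      using k[of i] u[of i] t by (intro powr_mono2) auto
    then have 2: "2 powr (S * k i) \<le> u i powr S" by (simp add: powr_powr mult.commute)
    have "(2 powr (S * k i))\<^sup>2 \<le> (u i powr S + 1)\<^sup>2" "1\<^sup>2 \<le> (u i powr S + 1)\<^sup>2"
      using 2 by (intro power_mono; simp)+
    then have 3: "2 powr (2 * S * k i) \<le> (u i powr S + 1)\<^sup>2" "1 \<le> (u i powr S + 1)\<^sup>2"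
      by (simp_all add: powr_power mult_ac)
    have "1 / (u i powr S + 1)\<^sup>2 \<le> 1 / 2 powr (2 * S * k i)" "1 / (u i powr S + 1)\<^sup>2 \<le> 1"
      using 3 by (intro divide_left_mono; simp add: add_nonneg_eq_0_iff; fail)
                 (use 3 in \<open>simp add: divide_le_eq_1\<close>)
    then have 4: "1 / (u i powr S + 1)\<^sup>2 \<le> min 1 (2 powr (- 2 * S * k i))"
      by (simp add: powr_minus_divide)
    have "?g i = u i powr t * (1 / (u i powr S + 1)\<^sup>2)" by simp
    also have "\<dots> \<le> (2 powr t * 2 powr (k i * t)) * min 1 (2 powr (- 2 * S * k i))"
      using 1 4 by (intro mult_mono) auto
    finally show ?thesis by (simp add: mult_ac)
  qed
  have decay: "2 powr (- \<alpha> * j) * (2 powr (j * t) * min 1 (2 powr (- 2 * S * j)))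
      \<le> (2 powr (- \<delta>)) ^ nat \<bar>j\<bar>" for j :: int
  proof (cases "j \<ge> 0")
    case True
    have "2 powr (- \<alpha> * j) * (2 powr (j * t) * min 1 (2 powr (- 2 * S * j)))
      \<le> 2 powr (- \<alpha> * j) * (2 powr (j * t) * 2 powr (- 2 * S * j))"
      by (intro mult_left_mono) auto
    also have "\<dots> = 2 powr (- (2 * S + \<alpha> - t) * j)"
      by (simp add: algebra_simps flip: powr_add)
    also have "\<dots> \<le> 2 powr (- \<delta> * j)"
      using True mult_right_mono[of \<delta> "2 * S + \<alpha> - t" "real_of_int j"]
      by (intro powr_mono) (auto simp: \<delta>_def minus_mult_left[symmetric] simp del: minus_diff_eq)
    finally show ?thesis using True by (simp add: powr_power mult.commute)
  next
    case False
    have "2 powr (- \<alpha> * j) * (2 powr (j * t) * min 1 (2 powr (- 2 * S * j)))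
      \<le> 2 powr (- \<alpha> * j) * (2 powr (j * t) * 1)"
      by (intro mult_left_mono) auto
    also have "\<dots> = 2 powr ((t - \<alpha>) * j)"
      by (simp add: algebra_simps flip: powr_add)
    also have "\<dots> \<le> 2 powr (\<delta> * j)"
      using False mult_right_mono_neg[of \<delta> "t - \<alpha>" "real_of_int j"] by (simp add: \<delta>_def)
    finally show ?thesis using False by (simp add: powr_power mult.commute)
  qed
  \<comment> \<open>Grouping the first \<open>n\<close> indices by shell keeps all sums finite, and
    a bound free of \<open>n\<close> gives summability and the estimate at once.\<close>
  have partial: "(\<Sum>i<n. ?g i) \<le> D * K" for n
  proof -
    have "(\<Sum>i<n. ?g i) = (\<Sum>j\<in>k ` {..<n}. \<Sum>i\<in>{i \<in> {..<n}. k i = j}. ?g i)"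
      by (rule sum.image_gen) simp
    also have "\<dots> \<le> (\<Sum>j\<in>k ` {..<n}. D * (2 powr t * (2 powr (- \<delta>)) ^ nat \<bar>j\<bar>))"
    proof (rule sum_mono)
      fix j :: int
      let ?M = "2 powr t * (2 powr (j * t) * min 1 (2 powr (- 2 * S * j)))"
      let ?I = "{i \<in> {..<n}. k i = j}"
      have "card ?I \<le> card {i. 2 powr j \<le> u i \<and> u i < 2 * 2 powr j}"
        using shell[of j] k by (intro card_mono) auto
      then have c: "real (card ?I) \<le> D * 2 powr (- \<alpha> * j)"
        using shell[of j] by linarith
      have "(\<Sum>i\<in>?I. ?g i) \<le> real (card ?I) * ?M"
        using term_le by (intro sum_bounded_above) auto
      also have "\<dots> \<le> D * 2 powr (- \<alpha> * j) * ?M"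
        using c by (intro mult_right_mono) auto
      also have "\<dots> = D * (2 powr t * (2 powr (- \<alpha> * j) * (2 powr (j * t) * min 1 (2 powr (- 2 * S * j)))))"
        by (simp only: mult_ac)
      also have "\<dots> \<le> D * (2 powr t * (2 powr (- \<delta>)) ^ nat \<bar>j\<bar>)"
        using decay D by (intro mult_left_mono) auto
      finally show "(\<Sum>i\<in>?I. ?g i) \<le> D * (2 powr t * (2 powr (- \<delta>)) ^ nat \<bar>j\<bar>)" .
    qed
    also have "\<dots> = D * (2 powr t * (\<Sum>j\<in>k ` {..<n}. (2 powr (- \<delta>)) ^ nat \<bar>j\<bar>))"
      by (simp add: sum_distrib_left)
    also have "\<dots> \<le> D * (2 powr t * (2 / (1 - 2 powr (- \<delta>))))"
      using D \<delta> by (intro mult_left_mono sum_int_geometric_le) (auto intro: powr_less_one)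
    finally show ?thesis by (simp add: K_def \<delta>_def)
  qed
  show s: "summable ?g" using partial by (intro summableI_nonneg_bounded) auto
  show "suminf ?g \<le> D * K" using s partial by (intro suminf_le_const)
qed


section \<open>Filter sums over a power spectrum\<close>

text \<open>A power spectrum with exponent \<open>\<alpha>\<close> has of the order of \<open>x powr (- \<alpha>)\<close> terms of size
  about \<open>x\<close>: polynomial decay gives \<open>\<alpha> = 1 / \<theta>\<close> and exponential decay \<open>\<alpha> = 0\<close>, that is,
  \<open>\<alpha> = \<beta> - 1\<close> in both cases.\<close>

locale power_spectrum =
  fixes lam :: "nat \<Rightarrow> real" and \<alpha> B D \<kappa> d x0 :: real
  assumes lam_pos: "0 < lam i" and lam_le: "lam i \<le> B"
    and alpha_nonneg: "0 \<le> \<alpha>"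
    and shell: "0 < x \<Longrightarrow> finite {i. x \<le> lam i \<and> lam i < 2 * x} \<and>
      real (card {i. x \<le> lam i \<and> lam i < 2 * x}) \<le> D * x powr (- \<alpha>)"
    and band: "0 < x \<Longrightarrow> x \<le> x0 \<Longrightarrow>
      \<exists>A. finite A \<and> d * x powr (- \<alpha>) \<le> real (card A) \<and> (\<forall>i\<in>A. \<kappa> * x \<le> lam i \<and> lam i \<le> x)"
    and consts_pos: "0 < \<kappa>" "0 < d" "0 < x0"
begin

definition filter_sum :: "real \<Rightarrow> real \<Rightarrow> real \<Rightarrow> real" where
  "filter_sum S t l = (\<Sum>i. lam i powr t / (lam i powr S + l)\<^sup>2)"

text \<open>Rescaling to \<open>u i = lam i / \<mu>\<close> takes
  \<open>\<mu> powr (t - 2 * S)\<close> out of every term and multiplies the shell counts by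
  \<open>\<mu> powr (- \<alpha>)\<close>. The parameter is written as \<open>\<mu> powr S\<close> so
  that \<open>\<mu>\<close> is on the scale of the eigenvalues.\<close>

lemma filter_sum_upper:
  assumes "\<alpha> < t" "t < 2 * S + \<alpha>"
  shows "0 < \<mu> \<Longrightarrow> summable (\<lambda>i. lam i powr t / (lam i powr S + \<mu> powr S)\<^sup>2)"
    and "\<exists>K>0. \<forall>\<mu>>0. filter_sum S t (\<mu> powr S) \<le> K * \<mu> powr (t - 2 * S - \<alpha>)"
proof -
  define K where "K = 2 powr t * (2 / (1 - 2 powr (- min (t - \<alpha>) (2 * S + \<alpha> - t))))"
  have *: "summable (\<lambda>i. lam i powr t / (lam i powr S + \<mu> powr S)\<^sup>2) \<and>
      filter_sum S t (\<mu> powr S) \<le> D * K * \<mu> powr (t - 2 * S - \<alpha>)" if \<mu>: "0 < \<mu>" for \<mu>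
  proof -
    define u where "u = (\<lambda>i. lam i / \<mu>)"
    have u: "0 < u i" for i using lam_pos \<mu> by (simp add: u_def)
    have "finite {i. 2 powr k \<le> u i \<and> u i < 2 * 2 powr k} \<and>
      real (card {i. 2 powr k \<le> u i \<and> u i < 2 * 2 powr k}) \<le> D * \<mu> powr (- \<alpha>) * 2 powr (- \<alpha> * k)"
      for k :: int
    proof -
      have "{i. 2 powr k \<le> u i \<and> u i < 2 * 2 powr k} =
        {i. 2 powr k * \<mu> \<le> lam i \<and> lam i < 2 * (2 powr k * \<mu>)}"
        using \<mu> by (auto simp: u_def field_simps)
      then show ?thesis using shell[of "2 powr k * \<mu>"] \<mu> by (simp add: powr_mult powr_powr mult_ac)
    qed
    note sh = dyadic_shell_sum[OF u this alpha_nonneg assms]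
    have eq: "lam i powr t / (lam i powr S + \<mu> powr S)\<^sup>2 =
      \<mu> powr (t - 2 * S) * (u i powr t / (u i powr S + 1)\<^sup>2)" for i
    proof -
      have l: "lam i = \<mu> * u i" using \<mu> by (simp add: u_def)
      have "lam i powr S + \<mu> powr S = \<mu> powr S * (u i powr S + 1)"
        using \<mu> u[of i] by (simp add: l powr_mult algebra_simps)
      moreover have "\<mu> powr (t - 2 * S) = \<mu> powr t / (\<mu> powr S)\<^sup>2"
        using \<mu> by (simp add: powr_diff powr_power)
      ultimately show ?thesis
        using \<mu> u[of i] by (simp add: l powr_mult power_mult_distrib)
    qed
    have "filter_sum S t (\<mu> powr S) = \<mu> powr (t - 2 * S) * (\<Sum>i. u i powr t / (u i powr S + 1)\<^sup>2)"
      unfolding filter_sum_def eq by (rule suminf_mult[OF sh(1)])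
    also have "\<dots> \<le> \<mu> powr (t - 2 * S) * (D * \<mu> powr (- \<alpha>) * K)"
      using sh(2) by (intro mult_left_mono) (auto simp: K_def)
    also have "\<dots> = D * K * (\<mu> powr (t - 2 * S) * \<mu> powr (- \<alpha>))" by (simp only: mult_ac)
    also have "\<mu> powr (t - 2 * S) * \<mu> powr (- \<alpha>) = \<mu> powr (t - 2 * S - \<alpha>)"
      by (simp flip: powr_add)
    finally show ?thesis unfolding eq using summable_mult[OF sh(1)] by blast
  qed
  then show "0 < \<mu> \<Longrightarrow> summable (\<lambda>i. lam i powr t / (lam i powr S + \<mu> powr S)\<^sup>2)" by blast
  \<comment> \<open>The maximum with 1 makes the constant positive, since \<open>D\<close> is not
    assumed to be.\<close>
  have "filter_sum S t (\<mu> powr S) \<le> max 1 (D * K) * \<mu> powr (t - 2 * S - \<alpha>)" if "0 < \<mu>" for \<mu>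
    using *[OF that] mult_right_mono[of "D * K" "max 1 (D * K)" "\<mu> powr (t - 2 * S - \<alpha>)"] by auto
  then show "\<exists>K>0. \<forall>\<mu>>0. filter_sum S t (\<mu> powr S) \<le> K * \<mu> powr (t - 2 * S - \<alpha>)"
    by (intro exI[of _ "max 1 (D * K)"]) auto
qed

text \<open>The eigenvalues are bounded, so \<open>lam i powr t\<close> is at most a constant times
  its filtered version with \<open>S = t\<close> and \<open>\<mu> = 1\<close>, which lies in the
  range of the shell estimate.\<close>

lemma summable_lam_powr:
  assumes "\<alpha> < t"
  shows "summable (\<lambda>i. lam i powr t)"
proof (rule summable_comparison_test)
  let ?g = "\<lambda>i. (B powr t + 1)\<^sup>2 * (lam i powr t / (lam i powr t + 1 powr t)\<^sup>2)"
  have "0 < t" using assms alpha_nonneg by simp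
  show "summable ?g"
    using assms \<open>0 < t\<close> alpha_nonneg by (intro summable_mult filter_sum_upper) auto
  have "lam i powr t \<le> ?g i" for i
  proof -
    have "lam i powr t \<le> B powr t"
      using lam_pos[of i] lam_le[of i] \<open>0 < t\<close> by (intro powr_mono2) auto
    then have "(lam i powr t + 1)\<^sup>2 \<le> (B powr t + 1)\<^sup>2" by (intro power_mono) auto
    then have "lam i powr t * (lam i powr t + 1)\<^sup>2 \<le> lam i powr t * (B powr t + 1)\<^sup>2"
      by (intro mult_left_mono) auto
    then show ?thesis
      using add_nonneg_pos[of "lam i powr t" 1]
      by (simp add: pos_le_divide_eq zero_less_power mult.commute)
  qed
  then show "\<exists>N. \<forall>i\<ge>N. norm (lam i powr t) \<le> ?g i" by auto
qed

text \<open>For fixed \<open>l\<close> the denominator is at least \<open>l\<^sup>2\<close>. This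
  gives convergence also for the large \<open>t\<close> outside the shell estimate.\<close>

lemma summable_filter:
  assumes "\<alpha> < t" "0 < l"
  shows "summable (\<lambda>i. lam i powr t / (lam i powr S + l)\<^sup>2)"
proof (rule summable_comparison_test)
  show "summable (\<lambda>i. lam i powr t * (1 / l\<^sup>2))"
    by (intro summable_mult2 summable_lam_powr assms)
  have "lam i powr t / (lam i powr S + l)\<^sup>2 \<le> lam i powr t / l\<^sup>2" for i
    using assms by (intro frac_le power_mono) auto
  then show "\<exists>N. \<forall>i\<ge>N. norm (lam i powr t / (lam i powr S + l)\<^sup>2) \<le> lam i powr t * (1 / l\<^sup>2)"
    by auto
qed

text \<open>Keeping only the eigenvalues in the band just below \<open>\<mu>\<close> suffices: there
  are at least \<open>d * \<mu> powr (- \<alpha>)\<close> of them, each numerator is at least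
  \<open>(\<kappa> * \<mu>) powr t\<close>, and each denominator is at most
  \<open>(2 * \<mu> powr S)\<^sup>2\<close>.\<close>

lemma filter_sum_lower:
  assumes "\<alpha> < t" "0 < S"
  shows "\<exists>k>0. \<forall>\<mu>. 0 < \<mu> \<and> \<mu> \<le> x0 \<longrightarrow> k * \<mu> powr (t - 2 * S - \<alpha>) \<le> filter_sum S t (\<mu> powr S)"
proof (intro exI conjI allI impI)
  show "0 < d * \<kappa> powr t / 4" using consts_pos by simp
  fix \<mu> :: real assume "0 < \<mu> \<and> \<mu> \<le> x0"
  then have \<mu>: "0 < \<mu>" "\<mu> \<le> x0" by auto
  obtain A where A: "finite A" "d * \<mu> powr (- \<alpha>) \<le> real (card A)"
      "\<And>i. i \<in> A \<Longrightarrow> \<kappa> * \<mu> \<le> lam i \<and> lam i \<le> \<mu>"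
    using band[OF \<mu>] by blast
  let ?m = "(\<kappa> * \<mu>) powr t / (2 * \<mu> powr S)\<^sup>2"
  have m: "?m \<le> lam i powr t / (lam i powr S + \<mu> powr S)\<^sup>2" if "i \<in> A" for i
  proof -
    have "(\<kappa> * \<mu>) powr t \<le> lam i powr t"
      using A(3)[OF that] consts_pos \<mu> assms alpha_nonneg by (intro powr_mono2) auto
    moreover have "lam i powr S \<le> \<mu> powr S"
      using A(3)[OF that] lam_pos[of i] assms by (intro powr_mono2) auto
    ultimately show ?thesis
      using lam_pos[of i] \<mu> by (intro frac_le power_mono zero_less_power add_pos_pos) auto
  qed
  have "d * \<kappa> powr t / 4 * \<mu> powr (t - 2 * S - \<alpha>) = d * \<mu> powr (- \<alpha>) * ?m"
    using \<mu> consts_pos by (simp add: powr_mult powr_diff powr_add powr_minus_divide powr_power field_simps)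
  also have "\<dots> \<le> real (card A) * ?m"
    using A(2) by (intro mult_right_mono) auto
  also have "\<dots> \<le> (\<Sum>i\<in>A. lam i powr t / (lam i powr S + \<mu> powr S)\<^sup>2)"
    using m by (intro sum_bounded_below)
  also have "\<dots> \<le> filter_sum S t (\<mu> powr S)"
    unfolding filter_sum_def using A(1) assms \<mu> by (intro sum_le_suminf summable_filter) auto
  finally show "d * \<kappa> powr t / 4 * \<mu> powr (t - 2 * S - \<alpha>) \<le> filter_sum S t (\<mu> powr S)" .
qed

text \<open>The regime in which eigenvalues of size about \<open>l powr (1 / S)\<close> determine
  the sum; the substitution \<open>\<mu> = l powr (1 / S)\<close> combines the two one-sided
  bounds.\<close>

lemma filter_sum_order_mid:
  assumes "\<alpha> < t" "t < 2 * S + \<alpha>"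
  shows "\<exists>k1>0. \<exists>k2>0. \<forall>l. 0 < l \<and> l \<le> x0 powr S \<longrightarrow>
    k1 * l powr ((t - 2 * S - \<alpha>) / S) \<le> filter_sum S t l \<and>
    filter_sum S t l \<le> k2 * l powr ((t - 2 * S - \<alpha>) / S)"
proof -
  have S: "0 < S" using assms by simp
  obtain k1 k2 where k: "0 < k1" "0 < k2"
    "\<And>\<mu>. 0 < \<mu> \<Longrightarrow> \<mu> \<le> x0 \<Longrightarrow> k1 * \<mu> powr (t - 2 * S - \<alpha>) \<le> filter_sum S t (\<mu> powr S)"
    "\<And>\<mu>. 0 < \<mu> \<Longrightarrow> filter_sum S t (\<mu> powr S) \<le> k2 * \<mu> powr (t - 2 * S - \<alpha>)"
    using filter_sum_lower[OF assms(1) S] filter_sum_upper(2)[OF assms] by metis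
  have "k1 * l powr ((t - 2 * S - \<alpha>) / S) \<le> filter_sum S t l \<and>
    filter_sum S t l \<le> k2 * l powr ((t - 2 * S - \<alpha>) / S)" if "0 < l" "l \<le> x0 powr S" for l
  proof -
    have "l powr (1 / S) \<le> (x0 powr S) powr (1 / S)"
      using that S by (intro powr_mono2) auto
    then have "l powr (1 / S) \<le> x0" using S consts_pos by (simp add: powr_powr)
    moreover have "(l powr (1 / S)) powr S = l" using that S by (simp add: powr_powr)
    ultimately show ?thesis
      using k(3,4)[of "l powr (1 / S)"] that by (simp add: powr_powr)
  qed
  with k(1,2) show ?thesis by blast
qed

text \<open>Here \<open>t - 2 * S\<close> exceeds \<open>\<alpha>\<close>, so the series still
  converges after \<open>l\<close> is deleted from the denominators, which bounds it uniformly in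
  \<open>l\<close>. The first term alone keeps it away from 0.\<close>

lemma filter_sum_order_high:
  assumes "2 * S + \<alpha> < t" "0 < S"
  shows "\<exists>k1>0. \<exists>k2>0. \<forall>l. 0 < l \<and> l \<le> l0 \<longrightarrow> k1 \<le> filter_sum S t l \<and> filter_sum S t l \<le> k2"
proof (intro exI conjI allI impI)
  \<comment> \<open>Taking \<open>max l0 0\<close> keeps this constant positive for every real
    \<open>l0\<close>; no \<open>l\<close> qualifies when \<open>l0 \<le> 0\<close>.\<close>
  let ?k1 = "lam 0 powr t / (lam 0 powr S + max l0 0)\<^sup>2" and ?k2 = "\<Sum>i. lam i powr (t - 2 * S)"
  have s: "summable (\<lambda>i. lam i powr (t - 2 * S))" using assms by (intro summable_lam_powr) auto
  show "0 < ?k1" using lam_pos[of 0] by (simp add: add_pos_nonneg less_imp_neq[symmetric])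
  show "0 < ?k2" using s lam_pos by (intro suminf_pos) (auto simp: less_imp_neq[symmetric])
  fix l :: real assume l: "0 < l \<and> l \<le> l0"
  have sf: "summable (\<lambda>i. lam i powr t / (lam i powr S + l)\<^sup>2)"
    using l assms by (intro summable_filter) auto
  have "?k1 \<le> lam 0 powr t / (lam 0 powr S + l)\<^sup>2"
    using l lam_pos[of 0]
    by (intro frac_le power_mono zero_less_power add_pos_pos) auto
  also have "\<dots> = (\<Sum>i\<in>{0}. lam i powr t / (lam i powr S + l)\<^sup>2)" by simp
  also have "\<dots> \<le> filter_sum S t l"
    unfolding filter_sum_def using sf by (intro sum_le_suminf) auto
  finally show "?k1 \<le> filter_sum S t l" .
  have "lam i powr t / (lam i powr S + l)\<^sup>2 \<le> lam i powr (t - 2 * S)" for i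
  proof -
    have "lam i powr t / (lam i powr S + l)\<^sup>2 \<le> lam i powr t / (lam i powr S)\<^sup>2"
      using l lam_pos[of i] by (intro frac_le power_mono zero_less_power) auto
    also have "\<dots> = lam i powr (t - 2 * S)"
      using lam_pos[of i] by (simp add: powr_diff powr_power mult.commute)
    finally show ?thesis .
  qed
  then show "filter_sum S t l \<le> ?k2"
    unfolding filter_sum_def using sf s by (intro suminf_le)
qed

end

section \<open>The regularization error and its minimiser\<close>

text \<open>Only the squares of the coefficients enter the error, so the smoothness assumption is
  kept as a two-sided bound on them. The condition \<open>\<alpha> < 2 * r\<close> makes the bias
  sum, with \<open>t = 2 * r\<close>, converge.\<close>

locale source_condition = power_spectrum +
  fixes c :: "nat \<Rightarrow> real" and r s A1 A2 :: real
  assumes c_sq: "A1 * lam i powr (2 * r) \<le> (c i)\<^sup>2" "(c i)\<^sup>2 \<le> A2 * lam i powr (2 * r)"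
    and A1_pos: "0 < A1" and r_gt: "\<alpha> < 2 * r" and s_nonneg: "0 \<le> s"
begin

abbreviation "S \<equiv> s + 1"

lemma A2_pos: "0 < A2"
  using order_trans[OF c_sq[of 0]] A1_pos lam_pos[of 0]
    mult_right_le_imp_le[of A1 "lam 0 powr (2 * r)" A2] by simp

lemma error_bounds:
  assumes "\<alpha> < 2 * s + 1" "0 < l"
  shows "summable (\<lambda>i. (\<sigma>\<^sup>2 * lam i powr (2 * s + 1) + l\<^sup>2 * (c i)\<^sup>2) / (lam i powr S + l)\<^sup>2)"
    and "\<sigma>\<^sup>2 * filter_sum S (2 * s + 1) l + A1 * l\<^sup>2 * filter_sum S (2 * r) l
      \<le> regularization_error lam c s \<sigma> l"
    and "regularization_error lam c s \<sigma> l
      \<le> \<sigma>\<^sup>2 * filter_sum S (2 * s + 1) l + A2 * l\<^sup>2 * filter_sum S (2 * r) l"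
proof -
  let ?v = "\<lambda>i. lam i powr (2 * s + 1) / (lam i powr S + l)\<^sup>2"
  let ?w = "\<lambda>i. lam i powr (2 * r) / (lam i powr S + l)\<^sup>2"
  let ?e = "\<lambda>i. (\<sigma>\<^sup>2 * lam i powr (2 * s + 1) + l\<^sup>2 * (c i)\<^sup>2) / (lam i powr S + l)\<^sup>2"
  have v: "summable ?v" and w: "summable ?w"
    using assms r_gt by (auto intro: summable_filter)
  have lo: "\<sigma>\<^sup>2 * ?v i + A1 * l\<^sup>2 * ?w i \<le> ?e i" and hi: "?e i \<le> \<sigma>\<^sup>2 * ?v i + A2 * l\<^sup>2 * ?w i" for i
  proof -
    have 1: "l\<^sup>2 * (A1 * lam i powr (2 * r)) \<le> l\<^sup>2 * (c i)\<^sup>2" "l\<^sup>2 * (c i)\<^sup>2 \<le> l\<^sup>2 * (A2 * lam i powr (2 * r))"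
      using c_sq by (auto intro: mult_left_mono)
    \<comment> \<open>A general factor \<open>A\<close> covers both \<open>A1\<close> and
      \<open>A2\<close>.\<close>
    have 2: "\<sigma>\<^sup>2 * ?v i + A * l\<^sup>2 * ?w i =
        (\<sigma>\<^sup>2 * lam i powr (2 * s + 1) + l\<^sup>2 * (A * lam i powr (2 * r))) / (lam i powr S + l)\<^sup>2" for A
      by (simp add: add_divide_distrib mult_ac)
    show "\<sigma>\<^sup>2 * ?v i + A1 * l\<^sup>2 * ?w i \<le> ?e i" "?e i \<le> \<sigma>\<^sup>2 * ?v i + A2 * l\<^sup>2 * ?w i"
      unfolding 2 using 1 by (auto intro!: divide_right_mono)
  qed
  have sA: "summable (\<lambda>i. \<sigma>\<^sup>2 * ?v i + A * l\<^sup>2 * ?w i)" for A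
    using v w by (intro summable_add summable_mult)
  have eqA: "(\<Sum>i. \<sigma>\<^sup>2 * ?v i + A * l\<^sup>2 * ?w i) =
      \<sigma>\<^sup>2 * filter_sum S (2 * s + 1) l + A * l\<^sup>2 * filter_sum S (2 * r) l" for A
    unfolding filter_sum_def using v w
    by (simp only: suminf_add[symmetric] suminf_mult summable_mult)
  show e: "summable ?e"
    by (rule summable_comparison_test[OF _ sA[of A2]]) (use hi in auto)
  show "\<sigma>\<^sup>2 * filter_sum S (2 * s + 1) l + A1 * l\<^sup>2 * filter_sum S (2 * r) l
      \<le> regularization_error lam c s \<sigma> l"
    unfolding eqA[symmetric] regularization_error_def using lo sA e by (intro suminf_le)
  show "regularization_error lam c s \<sigma> l
      \<le> \<sigma>\<^sup>2 * filter_sum S (2 * s + 1) l + A2 * l\<^sup>2 * filter_sum S (2 * r) l"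
    unfolding eqA[symmetric] regularization_error_def using hi sA e by (intro suminf_le)
qed

text \<open>The factor \<open>l / (lam 0 powr S + l)\<close> increases with \<open>l\<close>, and
  the first coefficient is nonzero. Its bias therefore stays above a constant that depends on
  neither \<open>\<sigma>\<close> nor \<open>l\<close>.\<close>

lemma error_far:
  assumes "\<alpha> < 2 * s + 1" "0 < l0"
  shows "\<exists>k>0. \<forall>\<sigma> l. l0 \<le> l \<longrightarrow> k \<le> regularization_error lam c s \<sigma> l"
proof (intro exI conjI allI impI)
  let ?k = "(l0 / (lam 0 powr S + l0))\<^sup>2 * (c 0)\<^sup>2"
  have "0 < (c 0)\<^sup>2"
    using c_sq(1)[of 0] A1_pos lam_pos[of 0] by (intro less_le_trans[OF _ c_sq(1)]) simp
  moreover have "0 < lam 0 powr S + l0" using assms by (simp add: add_nonneg_pos)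
  ultimately show "0 < ?k" using assms by simp
  fix \<sigma> l :: real assume l: "l0 \<le> l"
  have "l0 * lam 0 powr S \<le> l * lam 0 powr S"
    using l by (intro mult_right_mono) auto
  then have "l0 * (lam 0 powr S + l) \<le> l * (lam 0 powr S + l0)"
    by (simp add: distrib_left mult.commute)
  then have "l0 / (lam 0 powr S + l0) \<le> l / (lam 0 powr S + l)"
    using l assms by (subst frac_le_eq) (auto simp: add_nonneg_eq_0_iff divide_le_0_iff mult.commute)
  then have "?k \<le> (l / (lam 0 powr S + l))\<^sup>2 * (c 0)\<^sup>2"
    using assms by (intro mult_right_mono power_mono) auto
  also have "\<dots> \<le> (\<sigma>\<^sup>2 * lam 0 powr (2 * s + 1) + l\<^sup>2 * (c 0)\<^sup>2) / (lam 0 powr S + l)\<^sup>2"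
    by (simp add: power_divide divide_right_mono)
  also have "\<dots> = (\<Sum>i\<in>{0}. (\<sigma>\<^sup>2 * lam i powr (2 * s + 1) + l\<^sup>2 * (c i)\<^sup>2) / (lam i powr S + l)\<^sup>2)"
    by simp
  also have "\<dots> \<le> regularization_error lam c s \<sigma> l"
    unfolding regularization_error_def using error_bounds(1)[of l \<sigma>] assms l
    by (intro sum_le_suminf) auto
  finally show "?k \<le> regularization_error lam c s \<sigma> l" .
qed

text \<open>Both regimes are treated together through the exponent \<open>q\<close> of the bias,
  whose sum carries the additional factor \<open>l\<^sup>2\<close>. The variance has exponent
  \<open>p = (1 + \<alpha>) / S\<close> in either regime, because \<open>2 * s + 1\<close> is always
  below \<open>2 * S + \<alpha>\<close>.\<close>

lemma minimizer_order_of_bias: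
  assumes a: "\<alpha> < 2 * s + 1" and l0: "0 < l0" "l0 \<le> x0 powr S" and q: "0 < q" and b: "0 < b1" "0 < b2"
    and bias: "\<And>l. 0 < l \<Longrightarrow> l \<le> l0 \<Longrightarrow> b1 * l powr (q - 2) \<le> filter_sum S (2 * r) l \<and>
        filter_sum S (2 * r) l \<le> b2 * l powr (q - 2)"
    and min: "\<And>\<sigma>. 0 < \<sigma> \<Longrightarrow> is_arg_min (regularization_error lam c s \<sigma>) (\<lambda>l. 0 < l) (x \<sigma>)"
  shows "same_order_at_0 x (\<lambda>\<sigma>. \<sigma> powr (2 / ((1 + \<alpha>) / S + q))) \<and>
    same_order_at_0 (\<lambda>\<sigma>. regularization_error lam c s \<sigma> (x \<sigma>)) (\<lambda>\<sigma>. \<sigma> powr (2 * q / ((1 + \<alpha>) / S + q)))"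
proof -
  have ex: "(2 * s + 1 - 2 * S - \<alpha>) / S = - ((1 + \<alpha>) / S)"
    by (simp add: minus_divide_left)
  obtain v1 v2 where v: "0 < v1" "0 < v2"
    "\<And>l. 0 < l \<Longrightarrow> l \<le> x0 powr S \<Longrightarrow> v1 * l powr (- ((1 + \<alpha>) / S)) \<le> filter_sum S (2 * s + 1) l \<and>
      filter_sum S (2 * s + 1) l \<le> v2 * l powr (- ((1 + \<alpha>) / S))"
    using filter_sum_order_mid[of "2 * s + 1" S, unfolded ex] a alpha_nonneg by auto
  obtain k0 where k0: "0 < k0" "\<And>\<sigma> l. l0 \<le> l \<Longrightarrow> k0 \<le> regularization_error lam c s \<sigma> l"
    using error_far[OF a l0(1)] by blast
  let ?k1 = "min v1 (A1 * b1)" and ?k2 = "max v2 (A2 * b2)"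
  have both: "?k1 * (\<sigma>\<^sup>2 * l powr (- ((1 + \<alpha>) / S)) + l powr q) \<le> regularization_error lam c s \<sigma> l"
    "regularization_error lam c s \<sigma> l \<le> ?k2 * (\<sigma>\<^sup>2 * l powr (- ((1 + \<alpha>) / S)) + l powr q)"
    if l: "0 < l" "l \<le> l0" for \<sigma> l
  proof -
    let ?V = "\<sigma>\<^sup>2 * l powr (- ((1 + \<alpha>) / S))" and ?W = "l powr q"
    have lq: "l powr q = l\<^sup>2 * l powr (q - 2)" using l by (simp add: powr_diff powr_numeral)
    have V: "v1 * ?V \<le> \<sigma>\<^sup>2 * filter_sum S (2 * s + 1) l" "\<sigma>\<^sup>2 * filter_sum S (2 * s + 1) l \<le> v2 * ?V"
    proof -
      let ?G = "filter_sum S (2 * s + 1) l" and ?y = "l powr (- ((1 + \<alpha>) / S))"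
      have "v1 * ?y \<le> ?G" "?G \<le> v2 * ?y" using v(3)[of l] l l0 by auto
      then have "\<sigma>\<^sup>2 * (v1 * ?y) \<le> \<sigma>\<^sup>2 * ?G" "\<sigma>\<^sup>2 * ?G \<le> \<sigma>\<^sup>2 * (v2 * ?y)"
        by (auto intro: mult_left_mono)
      then show "v1 * ?V \<le> \<sigma>\<^sup>2 * ?G" "\<sigma>\<^sup>2 * ?G \<le> v2 * ?V" by (simp_all only: mult_ac)
    qed
    have W: "A1 * b1 * ?W \<le> A1 * l\<^sup>2 * filter_sum S (2 * r) l"
      "A2 * l\<^sup>2 * filter_sum S (2 * r) l \<le> A2 * b2 * ?W"
    proof -
      let ?G = "filter_sum S (2 * r) l" and ?y = "l powr (q - 2)"
      have "A1 * l\<^sup>2 * (b1 * ?y) \<le> A1 * l\<^sup>2 * ?G" "A2 * l\<^sup>2 * ?G \<le> A2 * l\<^sup>2 * (b2 * ?y)"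
        using bias[OF l] A1_pos A2_pos by (intro mult_left_mono; simp)+
      then show "A1 * b1 * ?W \<le> A1 * l\<^sup>2 * ?G" "A2 * l\<^sup>2 * ?G \<le> A2 * b2 * ?W"
        unfolding lq by (simp_all only: mult_ac)
    qed
    have nn: "0 \<le> ?V" "0 \<le> ?W" by auto
    have "?k1 * ?V \<le> v1 * ?V" "?k1 * ?W \<le> A1 * b1 * ?W" "v2 * ?V \<le> ?k2 * ?V" "A2 * b2 * ?W \<le> ?k2 * ?W"
      using nn by (intro mult_right_mono; simp)+
    then show "?k1 * (?V + ?W) \<le> regularization_error lam c s \<sigma> l"
      "regularization_error lam c s \<sigma> l \<le> ?k2 * (?V + ?W)"
      unfolding distrib_left using V W error_bounds(2,3)[OF a l(1), of \<sigma>] by linarith+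
  qed
  have p: "0 < (1 + \<alpha>) / S" using alpha_nonneg s_nonneg by simp
  have kp: "0 < ?k1" "0 < ?k2" using v b A1_pos by auto
  show ?thesis
    using same_order_minimizer[OF p q kp k0(1) l0(1) both k0(2) min] by simp
qed

text \<open>With \<open>\<beta> = 1 + \<alpha>\<close> the threshold on \<open>s\<close> compares
  \<open>2 * r\<close> with \<open>2 * S + \<alpha>\<close>, which decides between the two regimes
  of the bias sum. The rest is arithmetic of exponents.\<close>

lemma minimizer_order:
  assumes a: "\<alpha> < 2 * s + 1"
    and min: "\<And>\<sigma>. 0 < \<sigma> \<Longrightarrow> is_arg_min (regularization_error lam c s \<sigma>) (\<lambda>l. 0 < l) (x \<sigma>)"
    and \<beta>: "\<beta> = 1 + \<alpha>"
  shows "(s > r - (\<beta> + 1) / 2 \<longrightarrow>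
            same_order_at_0 x (\<lambda>\<sigma>. \<sigma> powr ((2 * s + 2) / (2 * r + 1))) \<and>
            same_order_at_0 (\<lambda>\<sigma>. regularization_error lam c s \<sigma> (x \<sigma>))
              (\<lambda>\<sigma>. \<sigma> powr (2 - 2 * \<beta> / (2 * r + 1)))) \<and>
         (s < r - (\<beta> + 1) / 2 \<longrightarrow>
            same_order_at_0 x (\<lambda>\<sigma>. \<sigma> powr ((2 * s + 2) / (2 * s + 2 + \<beta>))) \<and>
            same_order_at_0 (\<lambda>\<sigma>. regularization_error lam c s \<sigma> (x \<sigma>))
              (\<lambda>\<sigma>. \<sigma> powr (2 - 2 * \<beta> / (2 * s + 2 + \<beta>))))"
proof (intro conjI[of "_ \<longrightarrow> _"] impI)
  have S: "0 < S" using s_nonneg by simp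
  have l0: "0 < x0 powr S" using consts_pos by simp
  show "same_order_at_0 x (\<lambda>\<sigma>. \<sigma> powr ((2 * s + 2) / (2 * r + 1))) \<and>
      same_order_at_0 (\<lambda>\<sigma>. regularization_error lam c s \<sigma> (x \<sigma>)) (\<lambda>\<sigma>. \<sigma> powr (2 - 2 * \<beta> / (2 * r + 1)))"
    if "s > r - (\<beta> + 1) / 2"
  proof -
    \<comment> \<open>Twice the exponent of \<open>l\<close> from the prefactor aside, the bias sum
      contributes \<open>(2 * r - 2 * S - \<alpha>) / S\<close>; adding the 2 of
      \<open>l\<^sup>2\<close> gives \<open>q\<close>.\<close>
    define q where "q = (2 * r - \<alpha>) / S"
    have q: "q > 0" using r_gt S by (simp add: q_def)
    have r: "2 * r < 2 * S + \<alpha>" using that \<beta> by (simp add: field_simps)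
    have e: "(2 * r - 2 * S - \<alpha>) / S = q - 2" using S by (simp add: q_def field_simps)
    obtain b1 b2 where b: "0 < b1" "0 < b2"
      "\<And>l. 0 < l \<Longrightarrow> l \<le> x0 powr S \<Longrightarrow> b1 * l powr (q - 2) \<le> filter_sum S (2 * r) l \<and>
        filter_sum S (2 * r) l \<le> b2 * l powr (q - 2)"
      using filter_sum_order_mid[OF r_gt r, unfolded e] by blast
    have sum: "(1 + \<alpha>) / S + q = (2 * r + 1) / S"
      unfolding q_def by (simp flip: add_divide_distrib)
    have r1: "2 * r + 1 > 0" using r_gt alpha_nonneg by simp
    have e1: "2 / ((2 * r + 1) / S) = (2 * s + 2) / (2 * r + 1)" by simp
    have e2: "2 * q / ((2 * r + 1) / S) = 2 - 2 * \<beta> / (2 * r + 1)"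
      using S r1 by (simp add: q_def \<beta> divide_simps)
    show ?thesis
      using minimizer_order_of_bias[OF a l0 order_refl q b min, unfolded sum e1 e2] .
  qed
  show "same_order_at_0 x (\<lambda>\<sigma>. \<sigma> powr ((2 * s + 2) / (2 * s + 2 + \<beta>))) \<and>
      same_order_at_0 (\<lambda>\<sigma>. regularization_error lam c s \<sigma> (x \<sigma>)) (\<lambda>\<sigma>. \<sigma> powr (2 - 2 * \<beta> / (2 * s + 2 + \<beta>)))"
    if "s < r - (\<beta> + 1) / 2"
  proof -
    have r: "2 * S + \<alpha> < 2 * r" using that \<beta> by (simp add: field_simps)
    obtain b1 b2 where b: "0 < b1" "0 < b2"
      "\<And>l. 0 < l \<Longrightarrow> l \<le> x0 powr S \<Longrightarrow> b1 \<le> filter_sum S (2 * r) l \<and> filter_sum S (2 * r) l \<le> b2"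
      using filter_sum_order_high[OF r S] by blast
    \<comment> \<open>A bias sum of constant order means \<open>q = 2\<close>, hence the trivial
      power.\<close>
    have bias: "b1 * l powr (2 - 2) \<le> filter_sum S (2 * r) l \<and> filter_sum S (2 * r) l \<le> b2 * l powr (2 - 2)"
      if "0 < l" "l \<le> x0 powr S" for l
      using b(3)[OF that] that by simp
    have r1: "2 * s + 2 + \<beta> > 0" using alpha_nonneg \<beta> s_nonneg by simp
    have sum: "(1 + \<alpha>) / S + 2 = (2 * s + 2 + \<beta>) / S"
      using S by (simp add: \<beta> field_simps)
    have e1: "2 / ((2 * s + 2 + \<beta>) / S) = (2 * s + 2) / (2 * s + 2 + \<beta>)" by simp
    have e2: "2 * 2 / ((2 * s + 2 + \<beta>) / S) = 2 - 2 * \<beta> / (2 * s + 2 + \<beta>)"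
      using S r1 by (simp add: field_simps)
    show ?thesis
      using minimizer_order_of_bias[OF a l0 order_refl _ b(1,2) bias min, unfolded sum e1 e2] by simp
  qed
qed

end


section \<open>Exponential and polynomial decay as power spectra\<close>

lemma card_nat_interval_le:
  fixes u v :: real
  assumes "u \<le> v"
  shows "finite {i::nat. u \<le> real i \<and> real i \<le> v}"
    and "real (card {i::nat. u \<le> real i \<and> real i \<le> v}) \<le> v - u + 1"
proof -
  let ?I = "{i::nat. u \<le> real i \<and> real i \<le> v}"
  have sub: "int ` ?I \<subseteq> {\<lceil>u\<rceil>..\<lfloor>v\<rfloor>}" by (auto simp: ceiling_le_iff le_floor_iff)
  show fin: "finite ?I"
    using finite_subset[OF sub] by (simp add: finite_image_iff)
  have "card ?I = card (int ` ?I)" by (simp add: card_image)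
  also have "\<dots> \<le> card {\<lceil>u\<rceil>..\<lfloor>v\<rfloor>}" using sub by (intro card_mono) auto
  finally have "real (card ?I) \<le> real (nat (\<lfloor>v\<rfloor> + 1 - \<lceil>u\<rceil>))" by simp
  also have "\<dots> \<le> v - u + 1" using assms by linarith
  finally show "real (card ?I) \<le> v - u + 1" .
qed

text \<open>On the logarithmic scale a shell is an index interval of length at most
  \<open>ln (2 * b / a) / \<theta>\<close>, whatever \<open>x\<close> is; hence the exponent 0. One
  index is enough for the band.\<close>

lemma power_spectrum_exponential:
  assumes "0 < a" "0 < \<theta>"
    and lam: "\<And>i. a * exp (- \<theta> * real i) \<le> lam i" "\<And>i. lam i \<le> b * exp (- \<theta> * real i)"
  shows "\<exists>D \<kappa> d x0. power_spectrum lam 0 b D \<kappa> d x0"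
proof (intro exI)
  have ab: "a \<le> b" using order_trans[OF lam(1)[of 0] lam(2)[of 0]] by simp
  have b: "0 < b" using ab assms by simp
  show "power_spectrum lam 0 b ((ln (2 * b / a)) / \<theta> + 1) (a * exp (- \<theta>) / b) 1 b"
  proof
    show "0 < lam i" for i using lam(1)[of i] assms by (intro less_le_trans[OF _ lam(1)]) simp
    have "b * exp (- \<theta> * real i) \<le> b * 1" for i using assms b by (intro mult_left_mono) auto
    then show "lam i \<le> b" for i using lam(2)[of i] by (simp add: order_trans)
    show "0 < a * exp (- \<theta>) / b" using assms b by simp
  next
    fix x :: real assume x: "0 < x"
    let ?u = "ln (a / (2 * x)) / \<theta>" and ?v = "ln (b / x) / \<theta>"
    have uv: "?v - ?u = ln (2 * b / a) / \<theta>"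
      using x assms b by (simp add: ln_div ln_mult field_simps)
    have "0 \<le> ln (2 * b / a)" using ab assms by (intro ln_ge_zero) (simp add: field_simps)
    then have le: "?u \<le> ?v" using uv assms by (metis diff_ge_0_iff_ge divide_nonneg_pos)
    have sub: "{i. x \<le> lam i \<and> lam i < 2 * x} \<subseteq> {i. ?u \<le> real i \<and> real i \<le> ?v}"
    proof clarify
      fix i assume i: "x \<le> lam i" "lam i < 2 * x"
      have "a * exp (- \<theta> * real i) \<le> 2 * x" "x \<le> b * exp (- \<theta> * real i)"
        using lam[of i] i by linarith+
      then have "a / (2 * x) \<le> exp (\<theta> * real i)" "exp (\<theta> * real i) \<le> b / x"
        using x by (simp_all add: exp_minus field_simps)
      then have "ln (a / (2 * x)) \<le> \<theta> * real i" "\<theta> * real i \<le> ln (b / x)"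
        using x assms b by (simp_all add: ln_le_cancel_iff[of _ "exp _", simplified] ln_ge_iff)
      then show "?u \<le> real i \<and> real i \<le> ?v" using assms by (simp add: field_simps)
    qed
    show "finite {i. x \<le> lam i \<and> lam i < 2 * x} \<and>
      real (card {i. x \<le> lam i \<and> lam i < 2 * x}) \<le> (ln (2 * b / a) / \<theta> + 1) * x powr (- 0)"
      using card_nat_interval_le[OF le] finite_subset[OF sub] card_mono[OF _ sub] uv x by simp
  next
    fix x :: real assume x: "0 < x" "x \<le> b"
    \<comment> \<open>The first index with \<open>b * exp (- \<theta> * real i) \<le> x\<close>.
      Rounding up costs at most a factor \<open>exp (- \<theta>)\<close>, and the gap between the
      two bounds on \<open>lam\<close> costs \<open>a / b\<close>; together they give
      \<kappa>.\<close>
    define i where "i = nat \<lceil>ln (b / x) / \<theta>\<rceil>"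
    have "0 \<le> ln (b / x) / \<theta>" using x assms by simp
    then have "ln (b / x) / \<theta> \<le> real i" "real i \<le> ln (b / x) / \<theta> + 1"
      unfolding i_def by linarith+
    then have i: "ln (b / x) \<le> \<theta> * real i" "\<theta> * real i \<le> ln (b / x) + \<theta>"
      using assms by (simp_all add: field_simps)
    have "b / x \<le> exp (\<theta> * real i)" "exp (\<theta> * real i) \<le> exp (ln (b / x) + \<theta>)"
      using i x b by (simp_all add: ln_le_cancel_iff[of _ "exp _", simplified])
    then have "b * exp (- \<theta> * real i) \<le> x" "exp (- \<theta>) * x / b \<le> exp (- \<theta> * real i)"
      using x b by (simp_all add: exp_add exp_minus field_simps)
    then have "lam i \<le> x" "a * (exp (- \<theta>) * x / b) \<le> lam i"
      using order_trans[OF lam(2)] order_trans[OF mult_left_mono lam(1)] assms(1)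
      by (auto simp del: times_divide_eq_right)
    then show "\<exists>A. finite A \<and> 1 * x powr (- 0) \<le> real (card A) \<and>
        (\<forall>i\<in>A. a * exp (- \<theta>) / b * x \<le> lam i \<and> lam i \<le> x)"
      using x by (intro exI[of _ "{i}"]) simp
  qed (use b in auto)
qed

text \<open>The upper envelope of the eigenvalues falls to \<open>x\<close> at the position
  \<open>X = (b / x) powr (1 / \<theta>)\<close>. At most \<open>X\<close> eigenvalues are therefore
  at least \<open>x\<close>, while the block of indices from about \<open>X\<close> to twice that
  supplies the band.\<close>

lemma power_spectrum_polynomial:
  assumes "0 < a" "0 < \<theta>"
    and lam: "\<And>i. a * real (i + 1) powr (- \<theta>) \<le> lam i" "\<And>i. lam i \<le> b * real (i + 1) powr (- \<theta>)"
  shows "\<exists>D \<kappa> d x0. power_spectrum lam (inverse \<theta>) b D \<kappa> d x0"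
proof (intro exI)
  have ab: "a \<le> b" using order_trans[OF lam(1)[of 0] lam(2)[of 0]] by simp
  have b: "0 < b" using ab assms by simp
  show "power_spectrum lam (inverse \<theta>) b (b powr inverse \<theta>) (a * 4 powr (- \<theta>) / b) (b powr inverse \<theta>) b"
  proof
    show "0 < lam i" for i using assms by (intro less_le_trans[OF _ lam(1)]) simp
    have "real (i + 1) powr (- \<theta>) \<le> 1" for i
      using powr_mono[of "- \<theta>" 0 "real (i + 1)"] assms by simp
    then have "b * real (i + 1) powr (- \<theta>) \<le> b * 1" for i using b by (intro mult_left_mono) auto
    then show "lam i \<le> b" for i using lam(2)[of i] by (simp add: order_trans)
    show "0 < a * 4 powr (- \<theta>) / b" using assms b by simp
  next
    fix x :: real assume x: "0 < x"
    define X where "X = (b / x) powr (1 / \<theta>)"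
    have X: "X = b powr inverse \<theta> * x powr (- inverse \<theta>)" "0 < X"
      using x b by (simp_all add: X_def powr_divide powr_minus_divide inverse_eq_divide)
    have sub: "{i. x \<le> lam i \<and> lam i < 2 * x} \<subseteq> {..<nat \<lfloor>X\<rfloor>}"
    proof clarify
      fix i assume i: "x \<le> lam i" "lam i < 2 * x"
      have "x \<le> b * real (i + 1) powr (- \<theta>)" using lam(2)[of i] i by linarith
      then have "real (i + 1) powr \<theta> \<le> b / x"
        using x by (simp add: powr_minus field_simps)
      then have "real (i + 1) \<le> X"
        unfolding X_def using assms by (intro le_root_of_powr_le) auto
      \<comment> \<open>Index \<open>i\<close> stands for position \<open>i + 1\<close>, so the
        bound on the position is strict for the index.\<close>
      then show "i < nat \<lfloor>X\<rfloor>" by linarith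
    qed
    have "real (card {i. x \<le> lam i \<and> lam i < 2 * x}) \<le> real (nat \<lfloor>X\<rfloor>)"
      using card_mono[OF _ sub] by simp
    also have "\<dots> \<le> X" using X(2) by linarith
    finally show "finite {i. x \<le> lam i \<and> lam i < 2 * x} \<and>
      real (card {i. x \<le> lam i \<and> lam i < 2 * x}) \<le> b powr inverse \<theta> * x powr (- inverse \<theta>)"
      using finite_subset[OF sub] X(1) by simp
  next
    fix x :: real assume x: "0 < x" "x \<le> b"
    define X where "X = (b / x) powr (1 / \<theta>)"
    have X: "X = b powr inverse \<theta> * x powr (- inverse \<theta>)"
      using x b by (simp add: X_def powr_divide powr_minus_divide inverse_eq_divide)
    have X1: "1 \<le> X" unfolding X_def using x assms by (intro ge_one_powr_ge_zero) auto
    have Xp: "X powr (- \<theta>) = x / b"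
      using x b assms by (simp add: X_def powr_powr powr_minus)
    \<comment> \<open>Since \<open>1 \<le> X\<close>, rounding up at most doubles \<open>X\<close>.
      Positions in the block are then at most \<open>4 * X\<close>, the source of
      \<open>4 powr (- \<theta>)\<close> in \<kappa>.\<close>
    define n where "n = nat \<lceil>X\<rceil>"
    have n: "X \<le> real n" "real n \<le> 2 * X" using X1 by (auto simp: n_def; linarith)+
    have "a * 4 powr (- \<theta>) / b * x \<le> lam i \<and> lam i \<le> x" if "i \<in> {n..<2 * n}" for i
    proof -
      have "n \<le> i" "i + 1 \<le> 2 * n" using that by auto
      then have "real n \<le> real i" "real (i + 1) \<le> 2 * real n" by linarith+
      then have i: "X \<le> real (i + 1)" "real (i + 1) \<le> 4 * X" using n by linarith+
      have "real (i + 1) powr (- \<theta>) \<le> X powr (- \<theta>)" "(4 * X) powr (- \<theta>) \<le> real (i + 1) powr (- \<theta>)"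
        using i X1 assms by (intro powr_mono2'; simp)+
      then have "b * real (i + 1) powr (- \<theta>) \<le> b * (x / b)"
        "a * (4 powr (- \<theta>) * (x / b)) \<le> a * real (i + 1) powr (- \<theta>)"
        using assms(1) b X1 unfolding Xp powr_mult by (intro mult_left_mono; simp)+
      then show ?thesis using lam[of i] b by simp
    qed
    then show "\<exists>A. finite A \<and> b powr inverse \<theta> * x powr (- inverse \<theta>) \<le> real (card A) \<and>
        (\<forall>i\<in>A. a * 4 powr (- \<theta>) / b * x \<le> lam i \<and> lam i \<le> x)"
      using n(1) X by (intro exI[of _ "{n..<2 * n}"]) auto
  qed (use b assms in auto)
qed

section \<open>Deduction of the rates from the spectral assumptions\<close>

theorem theorem3p3:
  fixes \<rho> :: "'x::polish_space measure"
    and L :: "('x \<Rightarrow> real) \<Rightarrow> ('x \<Rightarrow> real)"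
    and lam c p pt :: "nat \<Rightarrow> real"
    and \<psi> :: "nat \<Rightarrow> 'x \<Rightarrow> real"
    and \<phi> :: "'x \<Rightarrow> real"
    and a b \<theta> r \<beta> s :: real
    and f lamstar :: "real \<Rightarrow> real"
  assumes "prob_space \<rho>" and "sets \<rho> = sets borel" and "compact (measure_support \<rho>)"
    and "L2_psd_selfadjoint \<rho> L" and "L2_trace_class \<rho> L"
    and "positive_eigensystem \<rho> L lam \<psi>"
    and "0 < a" and "a \<le> b"
    and cases: "(0 < \<theta> \<and> f = (\<lambda>x. exp (- \<theta> * (x - 1))) \<and> 0 < r \<and> \<beta> = 1) \<or>
                (1 < \<theta> \<and> f = (\<lambda>x. x powr (- \<theta>)) \<and> 1 / (2 * \<theta>) < r \<and> \<beta> = inverse \<theta> + 1)"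
    and decay: "\<And>i. lam i = inverse (p i) * f (real (i + 1))"
    and "\<And>i. a \<le> inverse (p i) \<and> inverse (p i) \<le> b"
    and "L2_sums \<rho> (\<lambda>i x. c i * \<psi> i x) \<phi>"
    and "\<phi> \<in> sobolev_space \<rho> lam \<psi> r"
    and "\<And>i. \<bar>c i\<bar> = pt i * lam i powr r"
    and "\<And>i. a \<le> inverse (pt i) \<and> inverse (pt i) \<le> b"
    and "0 \<le> s"
    and minimizer: "\<And>\<sigma>. 0 < \<sigma> \<Longrightarrow>
          is_arg_min (regularization_error lam c s \<sigma>) (\<lambda>l. 0 < l) (lamstar \<sigma>)"
  shows "(s > r - (\<beta> + 1) / 2 \<longrightarrow>
            same_order_at_0 lamstar (\<lambda>\<sigma>. \<sigma> powr ((2 * s + 2) / (2 * r + 1))) \<and>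
            same_order_at_0 (\<lambda>\<sigma>. regularization_error lam c s \<sigma> (lamstar \<sigma>))
              (\<lambda>\<sigma>. \<sigma> powr (2 - 2 * \<beta> / (2 * r + 1)))) \<and>
         (s < r - (\<beta> + 1) / 2 \<longrightarrow>
            same_order_at_0 lamstar (\<lambda>\<sigma>. \<sigma> powr ((2 * s + 2) / (2 * s + 2 + \<beta>))) \<and>
            same_order_at_0 (\<lambda>\<sigma>. regularization_error lam c s \<sigma> (lamstar \<sigma>))
              (\<lambda>\<sigma>. \<sigma> powr (2 - 2 * \<beta> / (2 * s + 2 + \<beta>))))"
proof -
  define \<alpha> where "\<alpha> = \<beta> - 1"
  have q: "a * f (real (i + 1)) \<le> lam i \<and> lam i \<le> b * f (real (i + 1))" for i
  proof -
    have "0 \<le> f (real (i + 1))" using cases by auto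
    then show ?thesis using assms(11)[of i] by (auto simp: decay intro: mult_right_mono)
  qed
  \<comment> \<open>For polynomial decay, \<open>1 < \<theta>\<close> gives \<alpha> below 1, so the
    variance sum converges, and the lower bound on \<open>r\<close> is exactly
    \<open>\<alpha> < 2 * r\<close>.\<close>
  have al: "\<alpha> < 2 * r" "\<alpha> < 2 * s + 1"
  proof -
    have "inverse \<theta> < 1 \<and> inverse \<theta> < 2 * r" if "1 < \<theta>" "1 / (2 * \<theta>) < r"
      using that by (simp add: field_simps)
    then show "\<alpha> < 2 * r" "\<alpha> < 2 * s + 1" using cases \<open>0 \<le> s\<close> by (auto simp: \<alpha>_def)
  qed
  have "\<exists>D \<kappa> d x0. power_spectrum lam \<alpha> b D \<kappa> d x0"
    using cases
  proof (elim disjE conjE)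
    assume "0 < \<theta>" "f = (\<lambda>x. exp (- \<theta> * (x - 1)))" "\<beta> = 1"
    then show ?thesis
      using power_spectrum_exponential[of a \<theta> lam b] q \<open>0 < a\<close> by (simp add: \<alpha>_def)
  next
    assume "1 < \<theta>" "f = (\<lambda>x. x powr - \<theta>)" "\<beta> = inverse \<theta> + 1"
    then show ?thesis
      using power_spectrum_polynomial[of a \<theta> lam b] q \<open>0 < a\<close> by (simp add: \<alpha>_def)
  qed
  then obtain D \<kappa> d x0 where "power_spectrum lam \<alpha> b D \<kappa> d x0" by blast
  then interpret power_spectrum lam \<alpha> b D \<kappa> d x0 .
  have pt: "(1 / b)\<^sup>2 \<le> (pt i)\<^sup>2" "(pt i)\<^sup>2 \<le> (1 / a)\<^sup>2" for i
  proof -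
    \<comment> \<open>Positivity of the reciprocal also excludes \<open>pt i = 0\<close>, whose
      \<open>inverse\<close> is 0 by convention.\<close>
    have "0 < inverse (pt i)" using assms(15)[of i] \<open>0 < a\<close> by linarith
    then have "0 < pt i" by simp
    then have "1 / b \<le> pt i" "pt i \<le> 1 / a"
      using assms(15)[of i] \<open>0 < a\<close> \<open>a \<le> b\<close> by (auto simp: field_simps)
    then show "(1 / b)\<^sup>2 \<le> (pt i)\<^sup>2" "(pt i)\<^sup>2 \<le> (1 / a)\<^sup>2"
      using \<open>0 < pt i\<close> \<open>0 < a\<close> \<open>a \<le> b\<close> by (auto intro!: power_mono)
  qed
  have c_sq: "(c i)\<^sup>2 = (pt i)\<^sup>2 * lam i powr (2 * r)" for i
  proof -
    have "(c i)\<^sup>2 = \<bar>c i\<bar>\<^sup>2" by simp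
    also have "\<dots> = (pt i)\<^sup>2 * lam i powr (2 * r)"
      unfolding assms(14) using lam_pos[of i] by (simp add: power_mult_distrib powr_power mult.commute)
    finally show ?thesis .
  qed
  interpret source_condition lam \<alpha> b D \<kappa> d x0 c r s "(1 / b)\<^sup>2" "(1 / a)\<^sup>2"
  proof
    show "(1 / b)\<^sup>2 * lam i powr (2 * r) \<le> (c i)\<^sup>2" "(c i)\<^sup>2 \<le> (1 / a)\<^sup>2 * lam i powr (2 * r)" for i
      unfolding c_sq using pt by (auto intro: mult_right_mono)
  qed (use al \<open>0 < a\<close> \<open>a \<le> b\<close> \<open>0 \<le> s\<close> in auto)
  show ?thesis
    by (rule minimizer_order[OF al(2) minimizer]) (simp_all add: \<alpha>_def)
qed

end
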